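(* For any positive integers $m$ and $d$ with $d\geq 3$, we have $$I^m(\mathbb{B}^d)\leq (d-1)m+1+\left\lceil\frac{m}{2}\right\rceil,$$ where $\mathbb{B}^d$ is the closed unit ball of $\mathbb{E}^d$ centered at the origin.
   Context: $\mathbb{E}^d$ is $d$-dimensional Euclidean space and $\mathbb{S}^{d-1}$ is its origin-centered unit sphere. A $d$-dimensional convex body is a compact convex subset of $\mathbb{E}^d$ with nonempty interior; $\partial K$ and $\operatorname{int}(K)$ denote boundary and interior. A direction $u\in\mathbb{S}^{d-1}$ illuminates a point $p\in\partial K$ with respect to a convex body $K$ if $p+\lambda u\in\operatorname{int}(K)$ for some $\lambda>0$. $K$ is $m$-fold illuminated by a finite multiset $U$ of directions in $\mathbb{S}^{d-1}$ if each point of $\partial K$ is illuminated by at least $m$ members of $U$ (counted with multiplicity) with respect to $K$. The $m$-fold illumination number $I^m(K)$ is the smallest cardinality (counted with multiplicity) of a multiset of directions that $m$-fold illuminates $K$. *)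

theory Defs
  imports
    "HOL-Analysis.Analysis"
    "HOL-Library.Multiset"
    "HOL-Library.Extended_Nat"
begin

text \<open>
  Euclidean \<open>d\<close>-space is an arbitrary type of class \<open>euclidean_space\<close> with \<open>DIM('a) = d\<close>.
  The definitions make sense for any set \<open>K\<close>; they are meant for convex bodies.
\<close>

definition illuminates :: "'a::euclidean_space set \<Rightarrow> 'a \<Rightarrow> 'a \<Rightarrow> bool" where
  "illuminates K u p \<longleftrightarrow> (\<exists>t>0. p + t *\<^sub>R u \<in> interior K)"

definition fold_illuminates :: "nat \<Rightarrow> 'a::euclidean_space multiset \<Rightarrow> 'a set \<Rightarrow> bool" where
  "fold_illuminates m U K \<longleftrightarrow>
     set_mset U \<subseteq> sphere 0 1 \<and>
     (\<forall>p\<in>frontier K. m \<le> size {#u \<in># U. illuminates K u p#})"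

text \<open>
  The value is taken in \<open>enat\<close> so that it is \<open>\<infinity>\<close> when no finite multiset \<open>m\<close>-fold
  illuminates \<open>K\<close>; over \<open>nat\<close> the infimum of the empty set would be \<open>0\<close>.
  Otherwise the infimum is attained, so it is the smallest cardinality.
\<close>

definition illumination_number :: "nat \<Rightarrow> 'a::euclidean_space set \<Rightarrow> enat" where
  "illumination_number m K = (INF U\<in>{U. fold_illuminates m U K}. enat (size U))"

end

theory Submission
  imports Defs "HOL-Computational_Algebra.Polynomial"
begin

text \<open>
  A direction illuminates a point \<open>p\<close> of the unit sphere iff its inner product with \<open>p\<close> is
  negative, so one needs \<open>2 m + d - 1\<close> directions (which is at most the claimed bound) of which
  every open hemisphere contains at least \<open>m\<close>. As in Gale's lemma, normalize the vectors
  \<open>(-1)\<^sup>i (1, i, \<dots>, i\<^sup>d\<^sup>-\<^sup>1)\<close> for \<open>i < 2 m + d - 1\<close>: their inner products with \<open>p\<close> are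
  \<open>(-1)\<^sup>i f(i)\<close> for a nonzero polynomial \<open>f\<close> of degree less than \<open>d\<close>. If fewer than \<open>m\<close> of them
  were negative, then multiplying \<open>f\<close> by \<open>(x - i)\<^sup>2 - 1/2\<close> for each of these indices \<open>i\<close> would
  flip exactly the offending signs. The alternating binomial sum of the product would consist of
  nonnegative terms, but it vanishes because the degree is too small; hence \<open>f\<close> would have too
  many zeros.
\<close>

text \<open>Up to sign the sum is the \<open>n\<close>-th finite difference of \<open>p\<close> at
  0. Pascal's rule turns the sum for \<open>p\<close> at \<open>Suc n\<close> into the sum at
  \<open>n\<close> for \<open>p - q\<close>, where \<open>q\<close> is \<open>p\<close> shifted by
  1.\<close>

lemma alternating_binomial_sum_poly:
  fixes p :: "real poly"
  assumes "degree p < n"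
  shows "(\<Sum>i\<le>n. (-1) ^ i * real (n choose i) * poly p (real i)) = 0"
  using assms
proof (induction n arbitrary: p)
  case 0
  then show ?case by simp
next
  case (Suc n)
  define q where "q = pcompose p [:1, 1:]"
  have q: "poly q x = poly p (1 + x)" for x
    by (simp add: q_def poly_pcompose)
  have dq: "degree q = degree p" "coeff q (degree p) = lead_coeff p"
    using lead_coeff_comp[of "[:1, 1:]" p] by (simp_all add: q_def degree_pcompose)
  let ?S = "\<lambda>r. \<Sum>i\<le>n. (-1) ^ i * real (n choose i) * poly r (real i)"
  have "(\<Sum>i\<le>Suc n. (-1) ^ i * real (Suc n choose i) * poly p (real i)) =
      poly p 0 + (\<Sum>i\<le>n. (-1) ^ Suc i * real (Suc n choose Suc i) * poly p (real (Suc i)))"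
    by (subst sum.atMost_Suc_shift) simp
  also have "(\<Sum>i\<le>n. (-1) ^ Suc i * real (Suc n choose Suc i) * poly p (real (Suc i))) =
      - ?S q + (\<Sum>i\<le>n. (-1) ^ Suc i * real (n choose Suc i) * poly p (real (Suc i)))"
    by (simp add: q algebra_simps sum.distrib sum_negf sum_subtractf)
  also have "poly p 0 + (- ?S q + (\<Sum>i\<le>n. (-1) ^ Suc i * real (n choose Suc i) * poly p (real (Suc i)))) =
      (\<Sum>i\<le>Suc n. (-1) ^ i * real (n choose i) * poly p (real i)) - ?S q"
    by (subst sum.atMost_Suc_shift) simp
  also have "\<dots> = ?S (p - q)"
    by (simp add: algebra_simps sum_subtractf)
  also have "\<dots> = 0"
  \<comment> \<open>The leading terms of \<open>p\<close> and \<open>q\<close> cancel, so the degree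
    drops, except for constant \<open>p\<close>, where the difference is 0.\<close>
  proof (cases "degree p = 0")
    case True
    then have "p - q = 0"
      by (metis degree_eq_zeroE pcompose_const q_def right_minus_eq)
    then show ?thesis by simp
  next
    case False
    have "degree (p - q) \<le> degree p" "coeff (p - q) (degree p) = 0"
      using dq by (simp_all add: degree_diff_le)
    then have "degree (p - q) < degree p"
      using False by (metis leading_coeff_0_iff degree_0 le_neq_implies_less not_gr_zero)
    then show ?thesis using Suc.prems by (intro Suc.IH) simp
  qed
  finally show ?case .
qed

lemma Gale_sign_count:
  fixes f :: "real poly"
  assumes "f \<noteq> 0" and "degree f < d"
  shows "m \<le> card {i. i < 2 * m + d - 1 \<and> (-1) ^ i * poly f (real i) < 0}"
proof (rule ccontr)
  define A where "A = {i. i < 2 * m + d - 1 \<and> (-1) ^ i * poly f (real i) < 0}"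
  assume "\<not> ?thesis"
  then have card: "card A < m" by (simp add: A_def)
  have fin: "finite A" by (simp add: A_def)
  \<comment> \<open>At integers, \<open>r i\<close> equals -1/2 at \<open>i\<close> and is at least
    1/2 elsewhere.\<close>
  define r where "r i = [:real i ^ 2 - 1/2, - 2 * real i, 1:]" for i
  have r: "poly (r i) (real j) = (real j - real i)\<^sup>2 - 1/2" for i j
    by (simp add: r_def power2_eq_square algebra_simps)
  have r_pos: "poly (r i) (real j) > 0" if "i \<noteq> j" for i j
  proof -
    have "1 \<le> \<bar>real j - real i\<bar>" using that by linarith
    then have "1 \<le> (real j - real i)\<^sup>2" by (metis one_le_power power2_abs)
    then show ?thesis by (simp add: r)
  qed
  define q where "q = (\<Prod>i\<in>A. r i)"
  have q_sign: "if j \<in> A then poly q (real j) < 0 else poly q (real j) > 0" for j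
  proof -
    have pos: "(\<Prod>i\<in>A - {j}. poly (r i) (real j)) > 0"
      by (intro prod_pos) (auto intro: r_pos)
    have "poly (r j) (real j) < 0" by (simp add: r)
    moreover have "poly q (real j) = poly (r j) (real j) * (\<Prod>i\<in>A - {j}. poly (r i) (real j))"
      if "j \<in> A"
      using that fin by (simp add: q_def poly_prod prod.remove)
    ultimately show ?thesis
      using pos by (auto simp: mult_neg_pos q_def poly_prod)
  qed
  define n where "n = 2 * m + d - 2"
  have n: "2 * m + d - 1 = Suc n" using card by (simp add: n_def)
  have "degree q \<le> (\<Sum>i\<in>A. degree (r i))"
    using degree_prod_sum_le[OF fin, of r] by (simp add: q_def o_def)
  then have "degree q \<le> 2 * card A"
    by (simp add: r_def numeral_2_eq_2)
  \<comment> \<open>The number of indices enters here: the degree is at most (d - 1) + 2 (m - 1) = n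
    - 1.\<close>
  then have "degree (f * q) < n"
    using degree_mult_le[of f q] card assms by (simp add: n_def)
  then have sum: "(\<Sum>i\<le>n. (-1) ^ i * real (n choose i) * poly (f * q) (real i)) = 0"
    by (rule alternating_binomial_sum_poly)
  have nonneg: "0 \<le> (-1) ^ i * real (n choose i) * poly (f * q) (real i)" if "i \<le> n" for i
  proof -
    have "0 \<le> ((-1) ^ i * poly f (real i)) * poly q (real i)"
    proof (cases "i \<in> A")
      case True
      then show ?thesis
        using q_sign[of i] by (intro mult_nonpos_nonpos) (auto simp: A_def)
    next
      case False
      then show ?thesis
        using q_sign[of i] that n by (intro mult_nonneg_nonneg[of "_ * _"]) (auto simp: A_def not_less)
    qed
    then have "0 \<le> real (n choose i) * (((-1) ^ i * poly f (real i)) * poly q (real i))"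
      by simp
    then show ?thesis by (simp add: mult_ac)
  qed
  have zero: "poly f (real i) = 0" if "i \<le> n" for i
  proof -
    have "(-1) ^ i * real (n choose i) * poly (f * q) (real i) = 0"
      using sum nonneg that by (subst (asm) sum_nonneg_eq_0_iff) auto
    then show ?thesis
      using that q_sign[of i] by (auto split: if_splits)
  qed
  \<comment> \<open>These are n + 1 = 2 m + d - 1 distinct zeros, more than the degree of
    \<open>f\<close> allows.\<close>
  have "card (real ` {..n}) \<le> card {x. poly f x = 0}"
    using zero by (intro card_mono poly_roots_finite assms) auto
  also have "\<dots> \<le> degree f"
    by (rule card_poly_roots_bound) fact
  finally show False
    using assms card by (simp add: card_image n_def)
qed

text \<open>The witness -(p \<bullet> u) leads to the foot of the perpendicular from the origin to
  the line through \<open>p\<close> along \<open>u\<close>, a point of squared norm 1 - (p \<bullet>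
  u)^2.\<close>

lemma illuminates_cball:
  fixes u p :: "'a::euclidean_space"
  assumes "norm u = 1" and "norm p = 1" and "p \<bullet> u < 0"
  shows "illuminates (cball 0 1) u p"
proof -
  let ?t = "- (p \<bullet> u)"
  have "(norm (p + ?t *\<^sub>R u))\<^sup>2 = 1 - (p \<bullet> u)\<^sup>2"
    using assms unfolding norm_eq_1 power2_norm_eq_inner
    by (simp add: algebra_simps inner_commute power2_eq_square)
  also have "\<dots> < 1" using assms by simp
  finally have "norm (p + ?t *\<^sub>R u) < 1"
    by (simp add: power_less_one_iff abs_square_less_1)
  then show ?thesis
    using assms unfolding illuminates_def by (intro exI[of _ ?t]) auto
qed

lemma illumination_number_cball_le:
  "illumination_number m (cball 0 1 :: 'a::euclidean_space set) \<le> enat (2 * m + DIM('a) - 1)"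
proof -
  define d where "d = DIM('a)"
  obtain b where b: "bij_betw b {..<d} (Basis :: 'a set)"
    using ex_bij_betw_nat_finite[of "Basis :: 'a set"] by (auto simp: d_def atLeast0LessThan)
  define v where "v i = (-1) ^ i *\<^sub>R (\<Sum>k<d. real i ^ k *\<^sub>R b k)" for i :: nat
  define f where "f p = (\<Sum>k<d. monom (p \<bullet> b k) k)" for p
  have inner_v: "p \<bullet> v i = (-1) ^ i * poly (f p) (real i)" for p i
    by (simp add: v_def f_def inner_sum_right poly_sum poly_monom mult_ac)
  have coeff_f: "coeff (f p) k = (if k < d then p \<bullet> b k else 0)" for p k
    by (simp add: f_def coeff_sum)
  have d: "0 < d" by (simp add: d_def)
  have deg_f: "degree (f p) < d" for p
    using d by (intro degree_lessI) (auto simp: coeff_f)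
  have f_nz: "f p \<noteq> 0" if "p \<noteq> 0" for p
  proof
    assume "f p = 0"
    then have "p \<bullet> b k = 0" if "k < d" for k
      using coeff_f[of p k] that by simp
    then have "p \<bullet> e = 0" if "e \<in> Basis" for e
      using b that by (force simp: bij_betw_def)
    then show False using that by (auto intro: euclidean_eqI)
  qed
  \<comment> \<open>Since \<open>sgn 0 = 0\<close>, only nonzero vectors normalize to directions.
    Pairing with \<open>b 0\<close> gives the constant polynomial 1, hence a nonzero inner
    product.\<close>
  have v_nz: "v i \<noteq> 0" for i
  proof
    assume "v i = 0"
    have "f (b 0) = 1"
    proof (rule poly_eqI)
      fix k
      have "b 0 \<bullet> b k = (if k = 0 then 1 else 0)" if "k < d"
      proof -
        have "b 0 \<in> Basis" "b k \<in> Basis"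
          using b that d by (auto simp: bij_betw_def)
        moreover have "b 0 = b k \<longleftrightarrow> k = 0"
          using b that d by (auto simp: bij_betw_def inj_on_eq_iff)
        ultimately show ?thesis by (simp add: inner_Basis)
      qed
      then show "coeff (f (b 0)) k = coeff 1 k"
        using d by (auto simp: coeff_f)
    qed
    then have "b 0 \<bullet> v i \<noteq> 0" by (simp add: inner_v)
    then show False using \<open>v i = 0\<close> by simp
  qed
  \<comment> \<open>A multiset image of the indices, so its size is the number of indices even if
    directions coincide.\<close>
  define U where "U = image_mset (\<lambda>i. sgn (v i)) (mset_set {..<2 * m + d - 1})"
  have "fold_illuminates m U (cball 0 1)"
    unfolding fold_illuminates_def
  proof (intro conjI ballI)
    show "set_mset U \<subseteq> sphere 0 1"
      using v_nz by (auto simp: U_def norm_sgn)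
    fix p :: 'a
    assume "p \<in> frontier (cball 0 1)"
    then have p: "norm p = 1" by simp
    let ?I = "{i \<in> {..<2 * m + d - 1}. illuminates (cball 0 1) (sgn (v i)) p}"
    have "m \<le> card {i. i < 2 * m + d - 1 \<and> p \<bullet> v i < 0}"
      unfolding inner_v using p by (intro Gale_sign_count f_nz deg_f) auto
    also have "\<dots> \<le> card ?I"
      using p v_nz
      by (intro card_mono) (auto intro!: illuminates_cball simp: norm_sgn sgn_div_norm mult_pos_neg)
    also have "\<dots> = size {#u \<in># U. illuminates (cball 0 1) u p#}"
      by (simp add: U_def filter_mset_image_mset)
    finally show "m \<le> size {#u \<in># U. illuminates (cball 0 1) u p#}" .
  qed
  then have "illumination_number m (cball 0 1 :: 'a set) \<le> enat (size U)"
    unfolding illumination_number_def by (intro INF_lower) simp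
  then show ?thesis by (simp add: U_def d_def)
qed

theorem theorem1p7:
  fixes m d :: nat
  assumes "m \<ge> 1" and "d \<ge> 3" and "DIM('a::euclidean_space) = d"
  shows "illumination_number m (cball 0 1 :: 'a set)
           \<le> enat ((d - 1) * m + 1 + nat \<lceil>real m / 2\<rceil>)"
proof -
  obtain e where e: "d = e + 3" using assms(2) by (metis add.commute le_Suc_ex)
  \<comment> \<open>With d = e + 3 the claim reads 2 m + e + 2 \<le> e m + 2 m + 1 +
    \<lceil>m/2\<rceil>, which follows from e \<le> e m and 1 \<le> \<lceil>m/2\<rceil>.\<close>
  have "1 \<le> nat \<lceil>real m / 2\<rceil>" using assms(1) by linarith
  moreover have "e \<le> e * m" using assms(1) by (cases m) auto
  moreover have "(d - 1) * m = e * m + 2 * m" by (simp add: e algebra_simps)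
  ultimately have "2 * m + d - 1 \<le> (d - 1) * m + 1 + nat \<lceil>real m / 2\<rceil>"
    using e by linarith
  then show ?thesis
    using illumination_number_cball_le[where 'a = 'a, of m] assms(3)
    by (meson enat_ord_simps(1) order_trans)
qed

end
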